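(* Let $G$ be a parity game and $\mathcal M=(M,<,\bot,\top,\upharpoonright,+)$ a regress measure space whose truncation operator is canonical. Let $\mu:V\to M$ be a regress measure. Then $D_+(\mu)\setminus D_0(\mu)$ is a weak quasi 0-dominion, and every $\mu$-coherent 0-strategy, once restricted to $D_+(\mu)\setminus D_0(\mu)$, is a 0-witness for it.
   Context: Parity game: finite disjoint $V_0,V_1$ (positions of players 0,1), $V=V_0\cup V_1$, move relation $E\subseteq V\times V$ with $E(v)=\{w:(v,w)\in E\}\neq\emptyset$ for all $v$, priority function $p:V\to P$, $P\subset\mathbb{N}$ finite. A positional $\alpha$-strategy on $U\subseteq V$ is $\sigma:U\cap V_\alpha\to V$ with $(v,\sigma(v))\in E$ (a strategy without qualifier is one on $V$; restriction to $U$ means restricting its domain to $U\cap V_\alpha$). For strategies $\sigma_0,\sigma_1$ on $U$ and $v\in U$, the play from $v$ in $U$ is the maximal finite or infinite sequence of positions of $U$ starting at $v$ whose successor at a $V_\alpha$ position is given by $\sigma_\alpha$. The priority of an infinite play is the maximal priority occurring infinitely often. $Q$ is a weak quasi 0-dominion if there is a 0-strategy $\sigma_0$ on $Q$ (a 0-witness) such that for every 1-strategy on $Q$ and $v\in Q$, if the induced play in $Q$ is infinite its priority is even. A measure space is $(M,<,\bot,\top,\upharpoonright,+)$ with $<$ a strict total order on $M$ with minimum $\bot$ and maximum $\top$, truncation $\upharpoonright:M\times V\to M$ (written $\eta\upharpoonright_v$) and stretch $+:M\times V\to M$. Truncation is canonical if $\eta=\top$ iff $\eta\upharpoonright_v=\top$,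 and $\eta\le\eta'$ implies $\eta\upharpoonright_v\le\eta'\upharpoonright_v$. It is a regress measure space if for all $\eta\in M$, $v\in V$: (1) $(\eta+v)\upharpoonright_v<\eta\upharpoonright_v$ whenever $\bot<\eta\upharpoonright_v<\top$ and $p(v)$ is odd; (2) $(\eta+v)\upharpoonright_u\le\eta\upharpoonright_u$ for all positions $u$ of odd priority with $p(v)\le p(u)$. For $\mu:V\to M$: $D_0(\mu)=\{v:\mu(v)\upharpoonright_v=\top\}$, $D_\bot(\mu)=\{v:\mu(v)\upharpoonright_v=\bot\}$, $D_+(\mu)=V\setminus D_\bot(\mu)$. $\mu$ is a regress measure if for all $v\in D_+(\mu)\setminus D_0(\mu)$: if $v\in V_0$, $\mu(v)\le\mu(w)+v$ for some $w\in E(v)$; if $v\in V_1$, $\mu(v)\le\mu(w)+v$ for all $w\in E(v)$. A 0-strategy $\sigma$ is $\mu$-coherent if $\mu(v)\le\mu(\sigma(v))+v$ for all $v\in V_0$. *)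

theory Defs
  imports Main
begin

record 'v pgame =
  pos0 :: "'v set"
  pos1 :: "'v set"
  moves :: "('v \<times> 'v) set"
  prios :: "nat set"
  prio :: "'v \<Rightarrow> nat"

definition pos :: "'v pgame \<Rightarrow> 'v set" where
  "pos G = pos0 G \<union> pos1 G"

definition parity_game :: "'v pgame \<Rightarrow> bool" where
  "parity_game G \<longleftrightarrow>
     finite (pos0 G) \<and> finite (pos1 G) \<and> pos0 G \<inter> pos1 G = {} \<and>
     moves G \<subseteq> pos G \<times> pos G \<and> (\<forall>v\<in>pos G. moves G `` {v} \<noteq> {}) \<and>
     finite (prios G) \<and> prio G ` pos G \<subseteq> prios G"

(* A positional strategy on U is a partial map whose domain is the set of positions of U owned by
   the player; the set A of all positions of the player stands for the player.  The chosen
   successors may lie outside U.  Restricting a strategy to U is map restriction. *)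
definition strategy_on :: "'v pgame \<Rightarrow> 'v set \<Rightarrow> 'v set \<Rightarrow> ('v \<rightharpoonup> 'v) \<Rightarrow> bool" where
  "strategy_on G A U \<sigma> \<longleftrightarrow>
     U \<subseteq> pos G \<and> dom \<sigma> = U \<inter> A \<and> (\<forall>v w. \<sigma> v = Some w \<longrightarrow> (v, w) \<in> moves G)"

abbreviation strategy0_on :: "'v pgame \<Rightarrow> 'v set \<Rightarrow> ('v \<rightharpoonup> 'v) \<Rightarrow> bool" where
  "strategy0_on G \<equiv> strategy_on G (pos0 G)"

abbreviation strategy1_on :: "'v pgame \<Rightarrow> 'v set \<Rightarrow> ('v \<rightharpoonup> 'v) \<Rightarrow> bool" where
  "strategy1_on G \<equiv> strategy_on G (pos1 G)"

(* The maximal play from v in U.  A finite or infinite sequence is encoded as a function into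
   options that is constantly None from the end of the sequence on; the play ends as soon as the
   next position is outside U. *)
primrec play ::
  "'v pgame \<Rightarrow> 'v set \<Rightarrow> ('v \<rightharpoonup> 'v) \<Rightarrow> ('v \<rightharpoonup> 'v) \<Rightarrow> 'v \<Rightarrow> nat \<Rightarrow> 'v option" where
  "play G U \<sigma>0 \<sigma>1 v 0 = (if v \<in> U then Some v else None)"
| "play G U \<sigma>0 \<sigma>1 v (Suc n) =
     (case play G U \<sigma>0 \<sigma>1 v n of
        None \<Rightarrow> None
      | Some x \<Rightarrow>
          (case (if x \<in> pos0 G then \<sigma>0 x else \<sigma>1 x) of
             None \<Rightarrow> None
           | Some y \<Rightarrow> if y \<in> U then Some y else None))"

definition infinite_play :: "(nat \<Rightarrow> 'v option) \<Rightarrow> bool" where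
  "infinite_play \<pi> \<longleftrightarrow> (\<forall>n. \<pi> n \<noteq> None)"

(* Meaningful only for infinite plays of a game: there the set is finite and nonempty. *)
definition play_priority :: "'v pgame \<Rightarrow> (nat \<Rightarrow> 'v option) \<Rightarrow> nat" where
  "play_priority G \<pi> = Max {k. infinite {n. prio G (the (\<pi> n)) = k}}"

definition witness0 :: "'v pgame \<Rightarrow> 'v set \<Rightarrow> ('v \<rightharpoonup> 'v) \<Rightarrow> bool" where
  "witness0 G Q \<sigma>0 \<longleftrightarrow>
     strategy0_on G Q \<sigma>0 \<and>
     (\<forall>\<sigma>1. strategy1_on G Q \<sigma>1 \<longrightarrow>
        (\<forall>v\<in>Q. infinite_play (play G Q \<sigma>0 \<sigma>1 v) \<longrightarrow>
               even (play_priority G (play G Q \<sigma>0 \<sigma>1 v))))"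

definition weak_quasi_dominion0 :: "'v pgame \<Rightarrow> 'v set \<Rightarrow> bool" where
  "weak_quasi_dominion0 G Q \<longleftrightarrow> Q \<subseteq> pos G \<and> (\<exists>\<sigma>0. witness0 G Q \<sigma>0)"

(* A measure space is given by a bounded linearly ordered type 'm together with a truncation
   tr and a stretch st; only their values at positions of the game matter. *)
definition canonical ::
  "'v pgame \<Rightarrow> ('m::{linorder,order_bot,order_top} \<Rightarrow> 'v \<Rightarrow> 'm) \<Rightarrow> bool" where
  "canonical G tr \<longleftrightarrow>
     (\<forall>v\<in>pos G. (\<forall>\<eta>. \<eta> = top \<longleftrightarrow> tr \<eta> v = top) \<and>
                (\<forall>\<eta> \<eta>'. \<eta> \<le> \<eta>' \<longrightarrow> tr \<eta> v \<le> tr \<eta>' v))"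

definition regress_measure_space ::
  "'v pgame \<Rightarrow> ('m::{linorder,order_bot,order_top} \<Rightarrow> 'v \<Rightarrow> 'm) \<Rightarrow> ('m \<Rightarrow> 'v \<Rightarrow> 'm) \<Rightarrow> bool" where
  "regress_measure_space G tr st \<longleftrightarrow>
     (\<forall>\<eta>. \<forall>v\<in>pos G.
        (bot < tr \<eta> v \<and> tr \<eta> v < top \<and> odd (prio G v) \<longrightarrow> tr (st \<eta> v) v < tr \<eta> v) \<and>
        (\<forall>u\<in>pos G. odd (prio G u) \<and> prio G v \<le> prio G u \<longrightarrow> tr (st \<eta> v) u \<le> tr \<eta> u))"

definition D0 ::
  "'v pgame \<Rightarrow> ('m::{linorder,order_bot,order_top} \<Rightarrow> 'v \<Rightarrow> 'm) \<Rightarrow> ('v \<Rightarrow> 'm) \<Rightarrow> 'v set" where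
  "D0 G tr \<mu> = {v \<in> pos G. tr (\<mu> v) v = top}"

definition Dbot ::
  "'v pgame \<Rightarrow> ('m::{linorder,order_bot,order_top} \<Rightarrow> 'v \<Rightarrow> 'm) \<Rightarrow> ('v \<Rightarrow> 'm) \<Rightarrow> 'v set" where
  "Dbot G tr \<mu> = {v \<in> pos G. tr (\<mu> v) v = bot}"

definition Dplus ::
  "'v pgame \<Rightarrow> ('m::{linorder,order_bot,order_top} \<Rightarrow> 'v \<Rightarrow> 'm) \<Rightarrow> ('v \<Rightarrow> 'm) \<Rightarrow> 'v set" where
  "Dplus G tr \<mu> = pos G - Dbot G tr \<mu>"

definition regress_measure ::
  "'v pgame \<Rightarrow> ('m::{linorder,order_bot,order_top} \<Rightarrow> 'v \<Rightarrow> 'm) \<Rightarrow> ('m \<Rightarrow> 'v \<Rightarrow> 'm) \<Rightarrow>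
     ('v \<Rightarrow> 'm) \<Rightarrow> bool" where
  "regress_measure G tr st \<mu> \<longleftrightarrow>
     (\<forall>v \<in> Dplus G tr \<mu> - D0 G tr \<mu>.
        (v \<in> pos0 G \<longrightarrow> (\<exists>w \<in> moves G `` {v}. \<mu> v \<le> st (\<mu> w) v)) \<and>
        (v \<in> pos1 G \<longrightarrow> (\<forall>w \<in> moves G `` {v}. \<mu> v \<le> st (\<mu> w) v)))"

(* The strategy is one on all positions, so the (\<sigma> v) is its chosen successor
   at every v in pos0 G. *)
definition coherent ::
  "'v pgame \<Rightarrow> ('m::{linorder,order_bot,order_top} \<Rightarrow> 'v \<Rightarrow> 'm) \<Rightarrow> ('v \<Rightarrow> 'm) \<Rightarrow>
     ('v \<rightharpoonup> 'v) \<Rightarrow> bool" where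
  "coherent G st \<mu> \<sigma> \<longleftrightarrow>
     strategy0_on G (pos G) \<sigma> \<and> (\<forall>v\<in>pos0 G. \<mu> v \<le> st (\<mu> (the (\<sigma> v))) v)"

end

theory Submission
  imports Defs "HOL-Library.Infinite_Set"
begin

text \<open>Along an infinite play in \<open>D\<^sub>+(\<mu>) - D\<^sub>0(\<mu>)\<close> that follows a coherent strategy, each step from
  \<open>x\<close> to \<open>y\<close> satisfies \<open>\<mu>(x) \<le> \<mu>(y) + x\<close>.  If the maximal priority occurring infinitely often were
  odd, fix a position \<open>u\<close> of that priority visited infinitely often.  From some point on,
  truncating the measures at this fixed \<open>u\<close> gives a nondecreasing sequence, which increases
  strictly whenever the play leaves \<open>u\<close>.  Between two visits of \<open>u\<close> its value would therefore
  exceed itself.\<close>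

text \<open>Unpacks the \<open>Max\<close> expression of \<open>play_priority\<close>. Finitely many
  values occur, so some recur and \<open>k\<close> is the largest of these; a second pigeonhole
  picks a single position of priority \<open>k\<close>.\<close>

lemma limsup_position:
  fixes x :: "nat \<Rightarrow> 'v" and f :: "'v \<Rightarrow> nat"
  assumes fin: "finite (range x)" and k: "k = Max {k. infinite {n. f (x n) = k}}"
  obtains u N where "f u = k" "\<exists>\<^sub>\<infinity>n. x n = u" "\<forall>n\<ge>N. f (x n) \<le> k"
proof -
  let ?K = "{k. infinite {n. f (x n) = k}}"
  have sub: "?K \<subseteq> range (\<lambda>n. f (x n))"
  proof
    fix j assume "j \<in> ?K"
    then have "{n. f (x n) = j} \<noteq> {}" by (metis finite.emptyI mem_Collect_eq)
    then show "j \<in> range (\<lambda>n. f (x n))" by auto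
  qed
  have finR: "finite (range (\<lambda>n. f (x n)))"
    using finite_imageI[OF fin, of f] by (simp add: image_image)
  have finK: "finite ?K"
    using finR sub by (rule rev_finite_subset)
  \<comment> \<open>Some value recurs, so the \<open>Max\<close> is taken over a nonempty set and is
    attained.\<close>
  obtain u0 where "infinite {n. x n = u0}"
    using pigeonhole_infinite[OF infinite_UNIV_nat fin] by auto
  then have "infinite {n. f (x n) = f u0}"
    by (rule infinite_super[rotated]) auto
  then have "?K \<noteq> {}" by blast
  with finK have "k \<in> ?K" unfolding k by (rule Max_in)
  then have infk: "infinite {n. f (x n) = k}" by simp
  have "finite (x ` {n. f (x n) = k})"
    using fin by (rule rev_finite_subset) auto
  from pigeonhole_infinite[OF infk this]
  obtain n0 where n0: "f (x n0) = k" "infinite {n \<in> {n. f (x n) = k}. x n = x n0}"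
    by auto
  have "infinite {n. x n = x n0}"
    using n0(2) by (rule infinite_super[rotated]) auto
  \<comment> \<open>Finitely many values above \<open>k\<close> occur, and by maximality each only
    finitely often.\<close>
  moreover have "finite {n. k < f (x n)}"
  proof -
    let ?J = "range (\<lambda>n. f (x n)) \<inter> {k<..}"
    have "finite {n. f (x n) = j}" if "j \<in> ?J" for j
      using Max_ge[OF finK, of j] that k by auto
    then have "finite (\<Union>j\<in>?J. {n. f (x n) = j})"
      using finR by blast
    then show ?thesis by (rule rev_finite_subset) auto
  qed
  then obtain N where "\<forall>n. k < f (x n) \<longrightarrow> n < N"
    by (metis finite_nat_set_iff_bounded mem_Collect_eq)
  ultimately show thesis
    using n0(1) that[of "x n0" N] by (metis INFM_iff_infinite linorder_not_le)
qed

text \<open>Separates the order argument from plays: strategies enter only through the step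
  inequality.\<close>

lemma regress_sequence_even:
  fixes tr st :: "'m::{linorder,order_bot,order_top} \<Rightarrow> 'v \<Rightarrow> 'm"
  assumes game: "parity_game G"
    and rms: "regress_measure_space G tr st"
    and can: "canonical G tr"
    and x: "\<And>n. x n \<in> Dplus G tr \<mu> - D0 G tr \<mu>"
    and step: "\<And>n. \<mu> (x n) \<le> st (\<mu> (x (Suc n))) (x n)"
  shows "even (Max {k. infinite {n. prio G (x n) = k}})"
proof (rule ccontr)
  define k where "k = Max {k. infinite {n. prio G (x n) = k}}"
  assume "odd (Max {k. infinite {n. prio G (x n) = k}})"
  then have "odd k" by (simp add: k_def)
  have xpos: "x n \<in> pos G" for n
    using x[of n] by (simp add: Dplus_def)
  have "finite (range x)"
    by (rule finite_subset[of _ "pos G"]) (use xpos game in \<open>auto simp: parity_game_def pos_def\<close>)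
  from limsup_position[OF this k_def]
  obtain u N where u: "prio G u = k" and inf: "\<exists>\<^sub>\<infinity>n. x n = u"
    and N: "\<forall>n\<ge>N. prio G (x n) \<le> k" .
  obtain i where i: "i \<ge> N" "x i = u"
    using inf by (auto simp: INFM_nat_le)
  obtain j where j: "j \<ge> Suc i" "x j = u"
    using inf by (auto simp: INFM_nat_le)
  have upos: "u \<in> pos G" using xpos[of i] i by simp
  define t where "t n = tr (\<mu> (x n)) u" for n
  have trunc: "t n \<le> tr (st (\<mu> (x (Suc n))) (x n)) u" for n
    using can step[of n] upos by (simp add: canonical_def t_def)
  have mono: "t n \<le> t (Suc n)" if "n \<ge> N" for n
  proof -
    \<comment> \<open>Clause (2) of a regress measure space, with \<open>u\<close> as the odd
      position and \<open>x n\<close> as the stretching one.\<close>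
    have "prio G (x n) \<le> prio G u" "odd (prio G u)"
      using N that u \<open>odd k\<close> by auto
    then have "tr (st (\<mu> (x (Suc n))) (x n)) u \<le> t (Suc n)"
      using rms xpos upos unfolding regress_measure_space_def t_def by blast
    with trunc[of n] show ?thesis by simp
  qed
  \<comment> \<open>Strictness at \<open>u\<close> needs \<open>t (Suc i)\<close> strictly between
    \<open>bot\<close> and \<open>top\<close>. Membership in \<open>Dplus\<close> excludes
    \<open>bot\<close> only for truncation at the position itself, so the lower bound starts at the
    visit \<open>x i = u\<close> and moves up by monotonicity.\<close>
  have "tr (\<mu> u) u \<noteq> bot"
    using x[of i] i upos by (auto simp: Dplus_def Dbot_def)
  then have "bot < t i" using i by (simp add: t_def bot.not_eq_extremum)
  also have "t i \<le> t (Suc i)" using mono i by simp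
  finally have gt_bot: "bot < t (Suc i)" .
  \<comment> \<open>For \<open>top\<close> canonicity makes the truncating position irrelevant, so
    the bound at \<open>x (Suc i)\<close> carries over to \<open>u\<close>.\<close>
  have top_iff: "tr \<eta> v = top \<longleftrightarrow> \<eta> = top" if "v \<in> pos G" for \<eta> v
    using bspec[OF can[unfolded canonical_def] that] by metis
  have "tr (\<mu> (x (Suc i))) (x (Suc i)) \<noteq> top"
    using x[of "Suc i"] xpos[of "Suc i"] by (simp add: D0_def)
  then have "t (Suc i) \<noteq> top"
    using top_iff xpos upos by (simp add: t_def)
  then have "t (Suc i) < top" by (simp add: top.not_eq_extremum)
  then have strict: "tr (st (\<mu> (x (Suc i))) u) u < t (Suc i)"
    using rms gt_bot u \<open>odd k\<close> upos unfolding regress_measure_space_def t_def by blast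
  have "t i < t (Suc i)" using trunc[of i] strict i by simp
  also have "t (Suc i) \<le> t j"
    using j(1)
  proof (induction j rule: dec_induct)
    case (step n)
    then show ?case using mono[of n] i(1) by auto
  qed simp
  also have "t j = t i" using i j by (simp add: t_def)
  finally show False by simp
qed

lemma play_SomeD:
  assumes "play G U \<sigma>0 \<sigma>1 v n = Some x"
  shows "x \<in> U"
  using assms by (cases n) (auto split: if_splits option.splits)

lemma play_SucD:
  assumes "play G U \<sigma>0 \<sigma>1 v n = Some x" "play G U \<sigma>0 \<sigma>1 v (Suc n) = Some y"
  shows "(if x \<in> pos0 G then \<sigma>0 x else \<sigma>1 x) = Some y"
  using assms by (auto split: if_splits option.splits)

text \<open>Asks for the inequality only where \<open>\<sigma>\<close> is defined, so that it covers
  both restricted coherent strategies and a strategy chosen on \<open>Q\<close> alone.\<close>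

lemma witness0_regress:
  fixes tr st :: "'m::{linorder,order_bot,order_top} \<Rightarrow> 'v \<Rightarrow> 'm"
  assumes game: "parity_game G"
    and rms: "regress_measure_space G tr st"
    and can: "canonical G tr"
    and rm: "regress_measure G tr st \<mu>"
    and Q: "Q = Dplus G tr \<mu> - D0 G tr \<mu>"
    and strat: "strategy0_on G Q \<sigma>"
    and coh: "\<And>v w. \<sigma> v = Some w \<Longrightarrow> \<mu> v \<le> st (\<mu> w) v"
  shows "witness0 G Q \<sigma>"
  unfolding witness0_def
proof (intro conjI allI impI ballI strat)
  fix \<sigma>1 v
  let ?\<pi> = "play G Q \<sigma> \<sigma>1 v"
  assume strat1: "strategy1_on G Q \<sigma>1" and inf: "infinite_play ?\<pi>"
  define x where "x n = the (?\<pi> n)" for n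
  have x: "?\<pi> n = Some (x n)" for n
    using inf by (auto simp: infinite_play_def x_def)
  have xQ: "x n \<in> Q" for n
    using x by (rule play_SomeD)
  have "\<mu> (x n) \<le> st (\<mu> (x (Suc n))) (x n)" for n
  proof (cases "x n \<in> pos0 G")
    case True
    then show ?thesis using play_SucD[OF x x, of n] coh by simp
  next
    case False
    \<comment> \<open>Player 1 moves here, and the regress condition bounds \<open>\<mu>\<close>
      along every move, whatever \<open>\<sigma>1\<close> picks.\<close>
    then have "\<sigma>1 (x n) = Some (x (Suc n))"
      using play_SucD[OF x x, of n] by simp
    then have "x n \<in> pos1 G" "(x n, x (Suc n)) \<in> moves G"
      using strat1 by (auto simp: strategy_on_def)
    then show ?thesis
      using rm xQ[of n] unfolding regress_measure_def Q by blast
  qed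
  then have "even (Max {k. infinite {n. prio G (x n) = k}})"
    using regress_sequence_even[OF game rms can] xQ unfolding Q by blast
  then show "even (play_priority G ?\<pi>)"
    by (simp add: play_priority_def x_def)
qed

theorem theorem12:
  fixes G :: "'v pgame"
    and tr st :: "'m::{linorder,order_bot,order_top} \<Rightarrow> 'v \<Rightarrow> 'm"
    and \<mu> :: "'v \<Rightarrow> 'm"
  assumes "parity_game G"
    and "regress_measure_space G tr st"
    and "canonical G tr"
    and "regress_measure G tr st \<mu>"
  shows "weak_quasi_dominion0 G (Dplus G tr \<mu> - D0 G tr \<mu>) \<and>
    (\<forall>\<sigma>. coherent G st \<mu> \<sigma> \<longrightarrow>
       witness0 G (Dplus G tr \<mu> - D0 G tr \<mu>) (\<sigma> |` (Dplus G tr \<mu> - D0 G tr \<mu>)))"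
proof (intro conjI allI impI)
  define Q where "Q = Dplus G tr \<mu> - D0 G tr \<mu>"
  note witness = witness0_regress[OF assms Q_def]
  have Qpos: "Q \<subseteq> pos G" by (auto simp: Q_def Dplus_def)
  \<comment> \<open>The regress condition yields good successors only on \<open>Q\<close>, not a
    coherent strategy on all positions; choosing them there suffices for existence of a
    witness.\<close>
  have "\<exists>w. (v, w) \<in> moves G \<and> \<mu> v \<le> st (\<mu> w) v" if "v \<in> Q \<inter> pos0 G" for v
    using assms(4) that unfolding regress_measure_def Q_def by blast
  then obtain s where s: "\<And>v. v \<in> Q \<inter> pos0 G \<Longrightarrow> (v, s v) \<in> moves G \<and> \<mu> v \<le> st (\<mu> (s v)) v"
    by metis
  let ?\<sigma> = "(\<lambda>v. Some (s v)) |` (Q \<inter> pos0 G)"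
  have "witness0 G Q ?\<sigma>"
  proof (rule witness)
    show "strategy0_on G Q ?\<sigma>"
      using Qpos s by (auto simp: strategy_on_def restrict_map_def split: if_splits)
    show "\<mu> v \<le> st (\<mu> w) v" if "?\<sigma> v = Some w" for v w
      using that s by (auto simp: restrict_map_def split: if_splits)
  qed
  with Qpos show "weak_quasi_dominion0 G (Dplus G tr \<mu> - D0 G tr \<mu>)"
    unfolding weak_quasi_dominion0_def Q_def by blast
  fix \<sigma> assume "coherent G st \<mu> \<sigma>"
  then have strat: "strategy0_on G (pos G) \<sigma>"
    and coh: "\<And>v. v \<in> pos0 G \<Longrightarrow> \<mu> v \<le> st (\<mu> (the (\<sigma> v))) v"
    by (auto simp: coherent_def)
  have "witness0 G Q (\<sigma> |` Q)"
  proof (rule witness)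
    have "dom (\<sigma> |` Q) = Q \<inter> pos0 G"
    proof -
      have "dom \<sigma> = pos G \<inter> pos0 G" using strat by (simp add: strategy_on_def)
      then show ?thesis using Qpos by auto
    qed
    then show "strategy0_on G Q (\<sigma> |` Q)"
      using Qpos strat by (auto simp: strategy_on_def restrict_map_def split: if_splits)
    show "\<mu> v \<le> st (\<mu> w) v" if "(\<sigma> |` Q) v = Some w" for v w
    proof -
      have "\<sigma> v = Some w" using that by (auto simp: restrict_map_def split: if_splits)
      moreover from this have "v \<in> pos0 G"
        using strat by (auto simp: strategy_on_def)
      ultimately show ?thesis using coh[of v] by simp
    qed
  qed
  then show "witness0 G (Dplus G tr \<mu> - D0 G tr \<mu>) (\<sigma> |` (Dplus G tr \<mu> - D0 G tr \<mu>))"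
    by (simp add: Q_def)
qed

end
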